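(* Let $\tilde\Pi(x)=a_0\,\phi^*\Pi(a)$ and, for each $l\in L$, let $$\tilde D_l=\prod_{j=1}^{l_0}\Big(a_0\frac{\partial}{\partial a_0}-j\Big)\prod_{i\ne0,\,l_i>0}\ \prod_{j=0}^{l_i-1}\Big(a_i\frac{\partial}{\partial a_i}-j\Big)-a^l\prod_{j=1}^{-l_0}\Big(a_0\frac{\partial}{\partial a_0}-j\Big)\prod_{i\neq0,\,l_i<0}\ \prod_{j=0}^{-l_i-1}\Big(a_i\frac{\partial}{\partial a_i}-j\Big).$$ Then $\tilde\Pi(x)$ is killed by the differential operator obtained from $\tilde D_l$ by the substitutions $$a_0\frac{\partial}{\partial a_0}\mapsto a_0\frac{\partial}{\partial a_0}-\mathcal L_{\sum_{j=1}^4X_j\frac{\partial}{\partial X_j}},\qquad a_j\frac{\partial}{\partial a_j}\mapsto a_j\frac{\partial}{\partial a_j}+\mathcal L_{X_j\frac{\partial}{\partial X_j}}\ (1\le j\le4),\qquad a_j\frac{\partial}{\partial a_j}\mapsto a_j\frac{\partial}{\partial a_j}\ (j>4).$$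
   Context: Let $\Delta^*$ be an integral polytope in $\mathbb R^4$ describing a family of Calabi–Yau hypersurfaces (anticanonical divisors) in a $4$-dimensional toric variety with toric coordinates $X=(X_1,\dots,X_4)$, with defining equation $f_{\Delta^*}(X)=\sum_{v_k^*\in\Delta^*}a_kX^{v_k^*}$, where $v_k^*$ ($k=0,1,2,\dots$) runs over the integral points of $\Delta^*$, $X^{v}=\prod_jX_j^{v_j}$, and the $a_k$ are parameters (with $a_0,\dots,a_4$ nonzero). It is assumed that $v_0^*=(0,0,0,0)$, $v_1^*=(1,0,0,0)$, $v_2^*=(0,1,0,0)$, $v_3^*=(0,0,1,0)$, $v_4^*=(0,0,0,1)$. Put $$\Pi(a)=\frac1{f_{\Delta^*}(X)}\prod_{j=1}^4\frac{dX_j}{X_j},$$ and let $\phi$ be the automorphism $X_i\mapsto\frac{a_0}{a_i}X_i$, $1\le i\le4$. Let $L=\{l=(l_0,l_1,\dots)\text{ integral}:\ \sum_il_i\bar v_i^*=0\}$ with $\bar v_i^*=(1,v_i^* )$, and $a^l=\prod_ia_i^{l_i}$. The form $\tilde\Pi$ depends on $a$ only through the variables $x_k=(-1)^{l_0^{(k)}}a^{l^{(k)}}$ for a basis $\{l^{(k)}\}$ of $L$. Products over empty ranges (e.g. $\prod_{j=1}^m$ with $m\le0$) equal $1$. $\mathcal L$ denotes the Lie derivative in the variables $X$. *)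

theory Defs
  imports "HOL-Analysis.Analysis"
begin

section \<open>Lattice points and integral polytopes\<close>

definition embed :: "int ^ 4 \<Rightarrow> real ^ 4" where
  "embed m = (\<chi> j. of_int (m $ j))"

definition integral_polytope :: "(real ^ 4) set \<Rightarrow> bool" where
  "integral_polytope \<Delta> \<longleftrightarrow> (\<exists>S. finite S \<and> S \<subseteq> range embed \<and> \<Delta> = convex hull S)"

definition lattice_points :: "(real ^ 4) set \<Rightarrow> (int ^ 4) set" where
  "lattice_points \<Delta> = {m. embed m \<in> \<Delta>}"

text \<open>
  The lattice \<open>L\<close> of integral relations among the vectors \<open>(1, v 0), \<dots>, (1, v p)\<close>; a relation is
  a function on the naturals that vanishes beyond \<open>p\<close>.
\<close>

definition relation_lattice :: "nat \<Rightarrow> (nat \<Rightarrow> int ^ 4) \<Rightarrow> (nat \<Rightarrow> int) set" where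
  "relation_lattice p v =
     {l. (\<forall>i>p. l i = 0) \<and>
         (\<Sum>i\<le>p. of_int (l i) *\<^sub>R ((1, embed (v i)) :: real \<times> (real ^ 4))) = 0}"


section \<open>Differential forms of degree 4 in four variables\<close>

text \<open>
  \<open>\<alpha> X w\<close> is the value at the point \<open>X\<close> of the form \<open>\<alpha>\<close> on the four tangent vectors
  \<open>w $ 1, \<dots>, w $ 4\<close>.
\<close>

type_synonym form4 = "complex ^ 4 \<Rightarrow> (complex ^ 4) ^ 4 \<Rightarrow> complex"

type_synonym vfield = "complex ^ 4 \<Rightarrow> complex ^ 4"

definition pullback :: "(complex ^ 4 \<Rightarrow> complex ^ 4) \<Rightarrow> form4 \<Rightarrow> form4" where
  "pullback g \<alpha> = (\<lambda>X w. \<alpha> (g X) (\<chi> i. frechet_derivative g (at X) (w $ i)))"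

text \<open>
  The coordinate formula for the Lie derivative of a covariant tensor along a vector field \<open>V\<close>:
  \<open>(L\<^sub>V \<alpha>)(w\<^sub>1,\<dots>,w\<^sub>4) = (D\<alpha> \<sqdot> V)(w\<^sub>1,\<dots>,w\<^sub>4) + (\<Sum>i. \<alpha>(w\<^sub>1,\<dots>,DV \<sqdot> w\<^sub>i,\<dots>,w\<^sub>4))\<close>.
  The derivatives are real Frechet derivatives; for holomorphic \<open>\<alpha>\<close> and \<open>V\<close> they are
  complex linear and agree with the holomorphic ones.
\<close>

definition lie :: "vfield \<Rightarrow> form4 \<Rightarrow> form4" where
  "lie V \<alpha> = (\<lambda>X w.
     frechet_derivative (\<lambda>Y. \<alpha> Y w) (at X) (V X) +
     (\<Sum>i\<in>UNIV. \<alpha> X (\<chi> k. if k = i then frechet_derivative V (at X) (w $ i) else w $ k)))"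

text \<open>The vector field \<open>X\<^sub>j \<partial>/\<partial>X\<^sub>j\<close>.\<close>

definition euler_field :: "4 \<Rightarrow> vfield" where
  "euler_field j = (\<lambda>X. axis j (X $ j))"

text \<open>
  The form \<open>dX\<^sub>1/X\<^sub>1 \<and> \<dots> \<and> dX\<^sub>4/X\<^sub>4\<close>: a wedge product of 1-forms takes the value
  \<open>det (\<theta>\<^sub>j(w\<^sub>i))\<close>.
\<close>

definition dlog_form :: form4 where
  "dlog_form = (\<lambda>X w. det (\<chi> i j. w $ i $ j / X $ j))"


section \<open>The family and its period form\<close>

definition laurent_monomial :: "complex ^ 4 \<Rightarrow> int ^ 4 \<Rightarrow> complex" where
  "laurent_monomial X m = (\<Prod>j\<in>UNIV. X $ j powi m $ j)"

definition defining_poly ::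
  "nat \<Rightarrow> (nat \<Rightarrow> int ^ 4) \<Rightarrow> (nat \<Rightarrow> complex) \<Rightarrow> complex ^ 4 \<Rightarrow> complex" where
  "defining_poly p v a X = (\<Sum>k\<le>p. a k * laurent_monomial X (v k))"

definition Pi_form :: "nat \<Rightarrow> (nat \<Rightarrow> int ^ 4) \<Rightarrow> (nat \<Rightarrow> complex) \<Rightarrow> form4" where
  "Pi_form p v a = (\<lambda>X w. 1 / defining_poly p v a X * dlog_form X w)"

definition phi :: "(nat \<Rightarrow> complex) \<Rightarrow> complex ^ 4 \<Rightarrow> complex ^ 4" where
  "phi a X = vector [a 0 / a 1 * X $ 1, a 0 / a 2 * X $ 2, a 0 / a 3 * X $ 3, a 0 / a 4 * X $ 4]"

text \<open>A form in the variables \<open>X\<close> depending on the parameters \<open>a\<close>.\<close>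

type_synonym pform = "(nat \<Rightarrow> complex) \<Rightarrow> form4"

definition Pi_tilde :: "nat \<Rightarrow> (nat \<Rightarrow> int ^ 4) \<Rightarrow> pform" where
  "Pi_tilde p v = (\<lambda>a X w. a 0 * pullback (phi a) (Pi_form p v a) X w)"


section \<open>Differential operators\<close>

text \<open>\<open>a\<^sub>k \<partial>/\<partial>a\<^sub>k\<close>\<close>

definition theta :: "nat \<Rightarrow> pform \<Rightarrow> pform" where
  "theta k F = (\<lambda>a X w. a k * deriv (\<lambda>t. F (a(k := t)) X w) (a k))"

text \<open>\<open>shifted_prod T [c\<^sub>1, \<dots>, c\<^sub>n]\<close> is the composite \<open>(T - c\<^sub>1) \<circ> \<dots> \<circ> (T - c\<^sub>n)\<close>.\<close>

definition shifted_prod :: "(pform \<Rightarrow> pform) \<Rightarrow> int list \<Rightarrow> pform \<Rightarrow> pform" where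
  "shifted_prod T cs =
     foldr (\<lambda>c G. (\<lambda>F a X w. T F a X w - of_int c * F a X w) \<circ> G) cs id"

definition op_prod :: "(nat \<Rightarrow> pform \<Rightarrow> pform) \<Rightarrow> nat list \<Rightarrow> pform \<Rightarrow> pform" where
  "op_prod S ks = foldr (\<lambda>k G. S k \<circ> G) ks id"

definition param_monomial :: "nat \<Rightarrow> (nat \<Rightarrow> complex) \<Rightarrow> (nat \<Rightarrow> int) \<Rightarrow> complex" where
  "param_monomial p a l = (\<Prod>i\<le>p. a i powi l i)"

text \<open>
  The operator \<open>D\<^sub>l\<close> with the operator \<open>T k\<close> in place of \<open>a\<^sub>k \<partial>/\<partial>a\<^sub>k\<close>; the operator
  before substitution is \<open>D_op theta p l\<close>. Here \<open>[m..n]\<close> is an integer interval, empty for \<open>n < m\<close>.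
\<close>

definition D_op :: "(nat \<Rightarrow> pform \<Rightarrow> pform) \<Rightarrow> nat \<Rightarrow> (nat \<Rightarrow> int) \<Rightarrow> pform \<Rightarrow> pform" where
  "D_op T p l F = (\<lambda>a X w.
     (shifted_prod (T 0) [1..l 0] \<circ>
      op_prod (\<lambda>i. shifted_prod (T i) [0..l i - 1]) [i \<leftarrow> [1..<Suc p]. l i > 0]) F a X w -
     param_monomial p a l *
     (shifted_prod (T 0) [1..- l 0] \<circ>
      op_prod (\<lambda>i. shifted_prod (T i) [0..- l i - 1]) [i \<leftarrow> [1..<Suc p]. l i < 0]) F a X w)"

text \<open>
  \<open>of_nat k\<close> is the \<open>k\<close>-th coordinate index; in the type \<open>4\<close>, where arithmetic is modulo 4, the
  numeral \<open>4\<close> is \<open>0\<close>.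
\<close>

definition theta_subst :: "nat \<Rightarrow> pform \<Rightarrow> pform" where
  "theta_subst k F = (\<lambda>a X w.
     if k = 0 then theta 0 F a X w - lie (\<lambda>Y. \<Sum>j\<in>UNIV. euler_field j Y) (F a) X w
     else if k \<le> 4 then theta k F a X w + lie (euler_field (of_nat k)) (F a) X w
     else theta k F a X w)"

end

theory Submission imports Defs begin

text \<open>
  Put \<open>Y = phi a X\<close>. The operators with the Lie derivatives added are the operators
  \<open>a\<^sub>k \<partial>/\<partial>a\<^sub>k\<close> written in the coordinates \<open>(a, Y)\<close>: the operator with index \<open>k\<close> differentiates
  along a vector field \<open>E\<^sub>k\<close> of the \<open>(a, X)\<close>-space, namely \<open>a\<^sub>k \<partial>/\<partial>a\<^sub>k\<close> corrected by a multiple of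
  Euler fields in \<open>X\<close>, and the correction is exactly the one for which \<open>E\<^sub>k\<close> annihilates every
  coordinate \<open>Y\<^sub>j = (a\<^sub>0 / a\<^sub>j) X\<^sub>j\<close> (lemma \<open>has_flow_deriv_phi\<close>). Since the logarithmic form is
  invariant both under \<open>phi a\<close> and under the Euler fields, only the coefficient function of a form
  \<open>g dlog\<close> is differentiated (lemma \<open>theta_subst_represents\<close>), and the form under study is
  \<open>a\<^sub>0 / f\<close> times the logarithmic form with \<open>f = \<Sum>\<^sub>i b\<^sub>i\<close> and \<open>b\<^sub>i = a\<^sub>i Y\<^bsup>v\<^sub>i\<^esup>\<close>.

  In these terms the statement is the classical GKZ computation. As \<open>E\<^sub>k b\<^sub>i\<close> is \<open>b\<^sub>i\<close> for
  \<open>i = k\<close> and \<open>0\<close> otherwise, the functions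
  \<open>M(k\<^sub>1,\<dots>,k\<^sub>n) = (-1)\<^sup>n n! a\<^sub>0 b\<^bsub>k\<^sub>1\<^esub> \<cdots> b\<^bsub>k\<^sub>n\<^esub> / f\<^bsup>n+1\<^esup>\<close> satisfy
  \<open>E\<^sub>k M(ks) = c M(ks) + M(k, ks)\<close>, where \<open>c\<close> is the number of occurrences of \<open>k\<close> in \<open>ks\<close>, plus
  \<open>1\<close> for \<open>k = 0\<close> because of the prefactor \<open>a\<^sub>0\<close>. The shifts in the operator remove the
  multiples of \<open>M(ks)\<close> one after the other, so that each of its two halves sends \<open>M()\<close> to a single
  \<open>M(ks)\<close> (lemma \<open>monomial_operator_term_form\<close>). The two resulting terms have the same number of
  factors because \<open>\<Sum>\<^sub>i l\<^sub>i = 0\<close>, and their quotient is \<open>\<Prod>\<^sub>i b\<^sub>i\<^bsup>l\<^sub>i\<^esup> = a\<^sup>l\<close> because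
  \<open>\<Sum>\<^sub>i l\<^sub>i v\<^sub>i = 0\<close> (lemma \<open>period_term_relation\<close>).

  The factors of the operator are applied in the order opposite to that in which the shifts cancel.
  They commute, but only on forms that can be differentiated repeatedly; the span of the functions
  \<open>M(ks)\<close> is a space of such forms that the operators preserve (lemmas \<open>period_span_deriv\<close> and
  \<open>shifted_commute\<close>).
\<close>

section \<open>Differentiation along the parameter flows\<close>

text \<open>
  The open set on which the period form is given by its formula. Identities between forms are only
  available there, but they may be differentiated because the set is open.
\<close>
definition regular ::
  "nat \<Rightarrow> (nat \<Rightarrow> int ^ 4) \<Rightarrow> (nat \<Rightarrow> complex) \<Rightarrow> complex ^ 4 \<Rightarrow> bool" where
  "regular p v a X \<longleftrightarrow>
     (\<forall>i\<le>4. a i \<noteq> 0) \<and> (\<forall>j. X $ j \<noteq> 0) \<and> defining_poly p v a (phi a X) \<noteq> 0"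

type_synonym scalar = "(nat \<Rightarrow> complex) \<Rightarrow> complex ^ 4 \<Rightarrow> complex"

text \<open>
  The \<open>X\<close>-component of \<open>E\<^sub>k\<close>. The sum of the four Euler fields is the identity field, whence the
  value for \<open>k = 0\<close>. For \<open>1 \<le> k \<le> 4\<close> the index \<open>of_nat k\<close> is reduced modulo \<open>4\<close>.
\<close>
definition flow_field :: "nat \<Rightarrow> vfield" where
  "flow_field k X = (if k = 0 then - X else if k \<le> 4 then euler_field (of_nat k) X else 0)"

text \<open>
  \<open>d\<close> is the derivative of \<open>g\<close> along \<open>E\<^sub>k\<close> at \<open>(a, X)\<close>. Only differentiability in \<open>a\<^sub>k\<close> alone and
  in \<open>X\<close> alone is demanded, as the operators take these two derivatives separately.
\<close>
definition has_flow_deriv :: "nat \<Rightarrow> scalar \<Rightarrow> complex \<Rightarrow> (nat \<Rightarrow> complex) \<Rightarrow> complex ^ 4 \<Rightarrow> bool" where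
  "has_flow_deriv k g d a X \<longleftrightarrow>
     (\<exists>e g'. ((\<lambda>t. g (a(k := t)) X) has_field_derivative e) (at (a k)) \<and>
             (g a has_derivative g') (at X) \<and> d = a k * e + g' (flow_field k X))"

lemma has_flow_deriv_const: "has_flow_deriv k (\<lambda>a X. c) 0 a X"
  unfolding has_flow_deriv_def
  by (intro exI[of _ 0] exI[of _ "\<lambda>_. 0"]) auto

lemma has_flow_deriv_add:
  assumes "has_flow_deriv k g d a X" and "has_flow_deriv k h e a X"
  shows "has_flow_deriv k (\<lambda>a X. g a X + h a X) (d + e) a X"
proof -
  from assms obtain d1 g' e1 h' where
    *: "((\<lambda>t. g (a(k := t)) X) has_field_derivative d1) (at (a k))" "(g a has_derivative g') (at X)"
      "d = a k * d1 + g' (flow_field k X)"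
      "((\<lambda>t. h (a(k := t)) X) has_field_derivative e1) (at (a k))" "(h a has_derivative h') (at X)"
      "e = a k * e1 + h' (flow_field k X)"
    unfolding has_flow_deriv_def by blast
  show ?thesis unfolding has_flow_deriv_def
    by (intro exI[of _ "d1 + e1"] exI[of _ "\<lambda>y. g' y + h' y"] conjI DERIV_add has_derivative_add *)
      (simp add: * algebra_simps)
qed

lemma has_flow_deriv_mult:
  assumes "has_flow_deriv k g d a X" and "has_flow_deriv k h e a X"
  shows "has_flow_deriv k (\<lambda>a X. g a X * h a X) (d * h a X + g a X * e) a X"
proof -
  from assms obtain d1 g' e1 h' where
    *: "((\<lambda>t. g (a(k := t)) X) has_field_derivative d1) (at (a k))" "(g a has_derivative g') (at X)"
      "d = a k * d1 + g' (flow_field k X)"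
      "((\<lambda>t. h (a(k := t)) X) has_field_derivative e1) (at (a k))" "(h a has_derivative h') (at X)"
      "e = a k * e1 + h' (flow_field k X)"
    unfolding has_flow_deriv_def by blast
  have "((\<lambda>t. g (a(k := t)) X * h (a(k := t)) X) has_field_derivative
      d1 * h a X + e1 * g a X) (at (a k))"
    using DERIV_mult[OF *(1,4)] by simp
  moreover have "((\<lambda>Y. g a Y * h a Y) has_derivative (\<lambda>y. g a X * h' y + g' y * h a X)) (at X)"
    by (intro has_derivative_mult *)
  ultimately show ?thesis unfolding has_flow_deriv_def
    by (intro exI conjI) (auto simp: * algebra_simps)
qed

lemma has_flow_deriv_chain:
  assumes "has_flow_deriv k g d a X" and "(u has_field_derivative u') (at (g a X))"
  shows "has_flow_deriv k (\<lambda>a X. u (g a X)) (u' * d) a X"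
proof -
  from assms obtain d1 g' where
    *: "((\<lambda>t. g (a(k := t)) X) has_field_derivative d1) (at (a k))" "(g a has_derivative g') (at X)"
      "d = a k * d1 + g' (flow_field k X)"
    unfolding has_flow_deriv_def by blast
  have "((\<lambda>t. u (g (a(k := t)) X)) has_field_derivative u' * d1) (at (a k))"
    using DERIV_chain2[of u u' "\<lambda>t. g (a(k := t)) X", OF _ *(1)] assms(2) by simp
  moreover have "((\<lambda>Y. u (g a Y)) has_derivative (\<lambda>y. u' * g' y)) (at X)"
    using has_derivative_compose[OF *(2) assms(2)[unfolded has_field_derivative_def]] .
  ultimately show ?thesis unfolding has_flow_deriv_def
    by (intro exI conjI) (auto simp: * algebra_simps)
qed

lemma has_flow_deriv_sum:
  assumes "finite I" and "\<And>i. i \<in> I \<Longrightarrow> has_flow_deriv k (g i) (d i) a X"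
  shows "has_flow_deriv k (\<lambda>a X. \<Sum>i\<in>I. g i a X) (\<Sum>i\<in>I. d i) a X"
  using assms by (induction I) (auto intro: has_flow_deriv_const has_flow_deriv_add)

lemma has_flow_deriv_prod_invariant:
  assumes "finite I" and "\<And>i. i \<in> I \<Longrightarrow> has_flow_deriv k (g i) 0 a X"
  shows "has_flow_deriv k (\<lambda>a X. \<Prod>i\<in>I. g i a X) 0 a X"
  using assms
proof (induction I)
  case (insert i I)
  then have "has_flow_deriv k (\<lambda>a X. g i a X * (\<Prod>i\<in>I. g i a X))
      (0 * (\<Prod>i\<in>I. g i a X) + g i a X * 0) a X"
    by (intro has_flow_deriv_mult) auto
  with insert show ?case by simp
qed (auto intro: has_flow_deriv_const)

lemma has_flow_deriv_param: "has_flow_deriv k (\<lambda>a X. a i) (if i = k then a i else 0) a X"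
proof -
  have "((\<lambda>t. (a(k := t)) i) has_field_derivative (if i = k then 1 else 0)) (at (a k))"
    by (auto intro!: derivative_eq_intros)
  then show ?thesis unfolding has_flow_deriv_def
    by (intro exI[of _ "if i = k then 1 else 0"] exI[of _ "\<lambda>_. 0"]) auto
qed

lemma has_flow_deriv_coordinate: "has_flow_deriv k (\<lambda>a X. X $ j) (flow_field k X $ j) a X"
  unfolding has_flow_deriv_def
  by (intro exI[of _ 0] exI[of _ "\<lambda>y. y $ j"])
    (auto intro!: derivative_eq_intros bounded_linear_imp_has_derivative bounded_linear_vec_nth)

lemma index_set: "{1..4} = {1, 2, 3, 4 :: nat}"
  by auto

lemma index_cases: "\<exists>i\<in>{1..4}. j = (of_nat i :: 4)"
  unfolding index_set using exhaust_4[of j] by auto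

lemma of_nat_index_eq:
  assumes "i \<in> {1..4}" "k \<in> {1..4}"
  shows "(of_nat i :: 4) = of_nat k \<longleftrightarrow> i = k"
  using assms unfolding index_set by auto

lemma phi_nth:
  assumes "i \<in> {1..4}"
  shows "phi a X $ of_nat i = a 0 / a i * X $ of_nat i"
  using assms unfolding index_set by (auto simp: phi_def vector_def)

text \<open>
  The reason for the choice of the substitution: rescaling \<open>a\<^sub>k\<close> rescales \<open>Y\<^sub>k\<close> inversely and
  rescaling \<open>a\<^sub>0\<close> rescales all \<open>Y\<^sub>j\<close>, and the \<open>X\<close>-component of \<open>E\<^sub>k\<close> undoes either effect.
\<close>
lemma has_flow_deriv_phi:
  assumes "\<forall>i\<le>4. a i \<noteq> 0"
  shows "has_flow_deriv k (\<lambda>a X. phi a X $ j) 0 a X"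
proof -
  obtain i where i: "i \<in> {1..4}" and j: "j = of_nat i" using index_cases by blast
  from assms i have nz: "a 0 \<noteq> 0" "a i \<noteq> 0" by auto
  have "has_flow_deriv k (\<lambda>a X. a 0 * inverse (a i) * X $ j)
      (((if 0 = k then a 0 else 0) * inverse (a i) +
        a 0 * (- (inverse (a i) ^ Suc (Suc 0)) * (if i = k then a i else 0))) * X $ j +
       a 0 * inverse (a i) * flow_field k X $ j) a X"
    by (intro has_flow_deriv_mult has_flow_deriv_param has_flow_deriv_coordinate
        has_flow_deriv_chain[where u = inverse, OF has_flow_deriv_param] DERIV_inverse nz)
  moreover have "((if 0 = k then a 0 else 0) * inverse (a i) +
        a 0 * (- (inverse (a i) ^ Suc (Suc 0)) * (if i = k then a i else 0))) * X $ j +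
       a 0 * inverse (a i) * flow_field k X $ j = 0"
    using i nz of_nat_index_eq[OF i, of k]
    by (auto simp: flow_field_def euler_field_def j axis_def field_simps)
  ultimately show ?thesis
    using i by (simp add: j phi_nth divide_inverse)
qed

text \<open>
  The functions \<open>b\<^sub>i\<close>, the summands of the defining polynomial at \<open>Y\<close>.
\<close>
definition poly_term :: "(nat \<Rightarrow> int ^ 4) \<Rightarrow> nat \<Rightarrow> scalar" where
  "poly_term v i a X = a i * laurent_monomial (phi a X) (v i)"

lemma phi_nonzero: "regular p v a X \<Longrightarrow> phi a X $ j \<noteq> 0"
  using index_cases[of j] by (auto simp: regular_def phi_nth)

lemma has_flow_deriv_poly_term:
  assumes "regular p v a X"
  shows "has_flow_deriv k (poly_term v i) (if i = k then poly_term v i a X else 0) a X"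
proof -
  have "has_flow_deriv k (\<lambda>a X. (phi a X $ j) powi m) 0 a X" for j m
  proof -
    have "((\<lambda>x. x powi m) has_field_derivative of_int m * (phi a X $ j) powi (m - 1) * 1)
        (at (phi a X $ j))"
      by (intro DERIV_power_int DERIV_ident disjI2 phi_nonzero[OF assms])
    from has_flow_deriv_chain[where g = "\<lambda>a X. phi a X $ j", OF has_flow_deriv_phi this] assms
    show ?thesis by (simp add: regular_def)
  qed
  then have "has_flow_deriv k (\<lambda>a X. laurent_monomial (phi a X) (v i)) 0 a X"
    unfolding laurent_monomial_def by (intro has_flow_deriv_prod_invariant) auto
  from has_flow_deriv_mult[OF has_flow_deriv_param this, of i] show ?thesis
    by (auto simp: poly_term_def[abs_def])
qed

lemma has_flow_deriv_defining_poly: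
  assumes "regular p v a X" and "k \<le> p"
  shows "has_flow_deriv k (\<lambda>a X. defining_poly p v a (phi a X)) (poly_term v k a X) a X"
  using has_flow_deriv_sum[of "{..p}" k "poly_term v" "\<lambda>i. if i = k then poly_term v i a X else 0" a X,
      OF _ has_flow_deriv_poly_term[OF assms(1)]] assms(2)
  by (simp add: defining_poly_def poly_term_def cong: if_cong)

lemma has_flow_deriv_eventually:
  assumes "has_flow_deriv k g d a X" and "g a X \<noteq> 0"
  shows "\<forall>\<^sub>F t in nhds (a k). g (a(k := t)) X \<noteq> 0" and "\<forall>\<^sub>F Y in nhds X. g a Y \<noteq> 0"
proof -
  from assms(1) obtain d1 g' where
    *: "((\<lambda>t. g (a(k := t)) X) has_field_derivative d1) (at (a k))" "(g a has_derivative g') (at X)"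
    unfolding has_flow_deriv_def by blast
  have "isCont (\<lambda>t. g (a(k := t)) X) (a k)" using *(1) by (rule DERIV_isCont)
  then have "((\<lambda>t. g (a(k := t)) X) \<longlongrightarrow> g a X) (nhds (a k))"
    using tendsto_at_iff_tendsto_nhds[of "\<lambda>t. g (a(k := t)) X" "a k"] by (simp add: isCont_def)
  then show "\<forall>\<^sub>F t in nhds (a k). g (a(k := t)) X \<noteq> 0"
    using assms(2) by (rule tendsto_imp_eventually_ne)
  have "isCont (g a) X" using *(2) by (rule has_derivative_continuous)
  then have "(g a \<longlongrightarrow> g a X) (nhds X)"
    by (simp add: isCont_def tendsto_at_iff_tendsto_nhds)
  then show "\<forall>\<^sub>F Y in nhds X. g a Y \<noteq> 0"
    using assms(2) by (rule tendsto_imp_eventually_ne)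
qed

text \<open>
  Openness in the directions in which the operators differentiate; the nonvanishing functions that
  define the set are continuous there because they have a derivative along \<open>E\<^sub>k\<close>.
\<close>
lemma regular_eventually:
  assumes "regular p v a X" and "k \<le> p"
  shows "\<forall>\<^sub>F t in nhds (a k). regular p v (a(k := t)) X" and "\<forall>\<^sub>F Y in nhds X. regular p v a Y"
proof -
  have "\<forall>\<^sub>F t in nhds (a k). \<forall>i\<in>{..4}. (a(k := t)) i \<noteq> 0"
    using assms by (intro eventually_ball_finite ballI
        has_flow_deriv_eventually(1)[OF has_flow_deriv_param]) (auto simp: regular_def)
  moreover have "\<forall>\<^sub>F t in nhds (a k). defining_poly p v (a(k := t)) (phi (a(k := t)) X) \<noteq> 0"
    using assms by (intro has_flow_deriv_eventually(1)[OF has_flow_deriv_defining_poly])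
      (auto simp: regular_def)
  ultimately show "\<forall>\<^sub>F t in nhds (a k). regular p v (a(k := t)) X"
    by eventually_elim (use assms(1) in \<open>auto simp: regular_def\<close>)
  have "\<forall>\<^sub>F Y in nhds X. \<forall>j. Y $ j \<noteq> 0"
    using assms by (intro eventually_all_finite
        has_flow_deriv_eventually(2)[OF has_flow_deriv_coordinate]) (auto simp: regular_def)
  moreover have "\<forall>\<^sub>F Y in nhds X. defining_poly p v a (phi a Y) \<noteq> 0"
    using assms by (intro has_flow_deriv_eventually(2)[OF has_flow_deriv_defining_poly])
      (auto simp: regular_def)
  ultimately show "\<forall>\<^sub>F Y in nhds X. regular p v a Y"
    by eventually_elim (use assms(1) in \<open>auto simp: regular_def\<close>)
qed

section \<open>The operators on multiples of the logarithmic form\<close>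

lemma dlog_form_eq: "dlog_form X w = det w * (\<Prod>j\<in>UNIV. inverse (X $ j))"
proof -
  have "(\<Prod>i\<in>UNIV. w $ i $ \<sigma> i / X $ \<sigma> i) = (\<Prod>i\<in>UNIV. w $ i $ \<sigma> i) * (\<Prod>j\<in>UNIV. inverse (X $ j))"
    if "\<sigma> permutes UNIV" for \<sigma> :: "4 \<Rightarrow> 4"
    using prod.permute[OF that, of "\<lambda>j. inverse (X $ j)"]
    by (simp add: divide_inverse prod.distrib o_def)
  then show ?thesis
    by (simp add: dlog_form_def det_def sum_distrib_right mult.assoc)
qed

text \<open>
  In the Leibniz expansion the \<open>i\<close>-th summand keeps just the permutations that send \<open>i\<close> to \<open>j\<close>, so
  each permutation is counted once. This is the trace of the projection to the \<open>j\<close>-th axis, by which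
  the derivative of an Euler field acts on volume forms.
\<close>
lemma sum_replace_row_det:
  fixes w :: "(complex ^ 4) ^ 4"
  shows "(\<Sum>i\<in>UNIV. det (\<chi> m. if m = i then axis j (w $ i $ j) else w $ m)) = det w"
proof -
  have *: "(\<Sum>i\<in>UNIV. \<Prod>m\<in>UNIV. (if m = i then axis j (w $ i $ j) else w $ m) $ \<sigma> m)
      = (\<Prod>m\<in>UNIV. w $ m $ \<sigma> m)" if "\<sigma> permutes UNIV" for \<sigma> :: "4 \<Rightarrow> 4"
  proof -
    have bij: "bij \<sigma>" using that by (rule permutes_bij)
    have "(\<Prod>m\<in>UNIV. (if m = i then axis j (w $ i $ j) else w $ m) $ \<sigma> m)
        = (if i = inv \<sigma> j then \<Prod>m\<in>UNIV. w $ m $ \<sigma> m else 0)" for i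
    proof (cases "\<sigma> i = j")
      case True
      then have "i = inv \<sigma> j" using bij by (simp add: bij_is_inj inv_f_eq)
      then show ?thesis using True by (auto simp: axis_def intro!: prod.cong)
    next
      case False
      then have "i \<noteq> inv \<sigma> j" using bij by (auto simp: bij_is_surj surj_f_inv_f)
      moreover have "(\<Prod>m\<in>UNIV. (if m = i then axis j (w $ i $ j) else w $ m) $ \<sigma> m) = 0"
        using False by (intro prod_zero bexI[of _ i]) (auto simp: axis_def)
      ultimately show ?thesis by simp
    qed
    then show ?thesis by simp
  qed
  show ?thesis
    unfolding det_def by (subst sum.swap) (simp add: * flip: sum_distrib_left)
qed

text \<open>
  The factor is the negative of the divergence of the \<open>X\<close>-component of \<open>E\<^sub>k\<close>; it cancels the
  determinant terms of the Lie derivative, which makes the logarithmic form invariant.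
\<close>
lemma has_flow_deriv_inverse_coordinates:
  assumes "\<forall>j. X $ j \<noteq> 0"
  shows "has_flow_deriv k (\<lambda>a X. \<Prod>j\<in>UNIV. inverse (X $ j))
    ((if k = 0 then 4 else if k \<le> 4 then - 1 else 0) * (\<Prod>j\<in>UNIV. inverse (X $ j))) a X"
proof -
  have *: "has_flow_deriv k (\<lambda>a X. inverse (X $ j))
      (- (inverse (X $ j) ^ Suc (Suc 0)) * flow_field k X $ j) a X" for j
    using assms by (intro has_flow_deriv_chain[where u = inverse, OF has_flow_deriv_coordinate]
        DERIV_inverse) auto
  have "has_flow_deriv k (\<lambda>a X. \<Prod>j\<in>J. inverse (X $ j))
      ((\<Sum>j\<in>J. - (inverse (X $ j) * flow_field k X $ j)) * (\<Prod>j\<in>J. inverse (X $ j))) a X"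
    if "finite J" for J
    using that
  proof (induction J)
    case (insert i J)
    have "- (inverse (X $ i) ^ Suc (Suc 0)) * flow_field k X $ i * (\<Prod>j\<in>J. inverse (X $ j)) +
        inverse (X $ i) * ((\<Sum>j\<in>J. - (inverse (X $ j) * flow_field k X $ j)) * (\<Prod>j\<in>J. inverse (X $ j))) =
        (\<Sum>j\<in>insert i J. - (inverse (X $ j) * flow_field k X $ j)) * (\<Prod>j\<in>insert i J. inverse (X $ j))"
      using insert.hyps by (simp add: algebra_simps)
    with has_flow_deriv_mult[OF * insert.IH, of i] insert.hyps show ?case by simp
  qed (auto intro: has_flow_deriv_const)
  from this[of UNIV] have "has_flow_deriv k (\<lambda>a X. \<Prod>j\<in>UNIV. inverse (X $ j))
      ((\<Sum>j\<in>UNIV. - (inverse (X $ j) * flow_field k X $ j)) * (\<Prod>j\<in>UNIV. inverse (X $ j))) a X"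
    by simp
  moreover have "(\<Sum>j\<in>UNIV. - (inverse (X $ j) * flow_field k X $ j)) =
      (if k = 0 then 4 else if k \<le> 4 then - 1 else 0)"
  proof -
    have "(\<Sum>j\<in>UNIV. - (inverse (X $ j) * flow_field k X $ j)) =
       (\<Sum>j::4\<in>UNIV. if k = 0 then 1 else if k \<le> 4 then (if j = of_nat k then - 1 else 0) else 0)"
      using assms by (intro sum.cong) (auto simp: flow_field_def euler_field_def axis_def)
    then show ?thesis by simp
  qed
  ultimately show ?thesis by simp
qed

definition represents :: "nat \<Rightarrow> (nat \<Rightarrow> int ^ 4) \<Rightarrow> pform \<Rightarrow> scalar \<Rightarrow> bool" where
  "represents p v F g \<longleftrightarrow> (\<forall>a X w. regular p v a X \<longrightarrow> F a X w = g a X * dlog_form X w)"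

lemma has_flow_deriv_cong:
  assumes "has_flow_deriv k h d a X"
    and "\<forall>\<^sub>F t in nhds (a k). g (a(k := t)) X = h (a(k := t)) X"
    and "\<forall>\<^sub>F Y in nhds X. g a Y = h a Y"
  shows "has_flow_deriv k g d a X"
proof -
  from assms(1) obtain e h' where
    *: "((\<lambda>t. h (a(k := t)) X) has_field_derivative e) (at (a k))" "(h a has_derivative h') (at X)"
      "d = a k * e + h' (flow_field k X)"
    unfolding has_flow_deriv_def by blast
  have "((\<lambda>t. g (a(k := t)) X) has_field_derivative e) (at (a k))"
    using *(1) DERIV_cong_ev[OF refl assms(2) refl] by simp
  moreover have "(g a has_derivative h') (at X)"
  proof (rule has_derivative_transform_eventually[OF *(2)])
    show "\<forall>\<^sub>F Y in at X. h a Y = g a Y"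
      using assms(3) by (auto simp: eventually_nhds_conv_at elim: eventually_mono)
    show "h a X = g a X"
      using eventually_nhds_x_imp_x[OF assms(3)] by simp
  qed simp
  ultimately show ?thesis unfolding has_flow_deriv_def using *(3) by blast
qed

text \<open>
  Splits the substituted operator into the derivative of the values of the form and the part of the
  Lie derivative that differentiates the vector field.
\<close>
lemma theta_subst_eq:
  assumes "has_flow_deriv k (\<lambda>a X. F a X w) d a X"
  shows "theta_subst k F a X w = d +
    (if k = 0 then - 4 * F a X w
     else if k \<le> 4 then
       \<Sum>i\<in>UNIV. F a X (\<chi> m. if m = i then axis (of_nat k) (w $ i $ of_nat k) else w $ m)
     else 0)"
proof -
  from assms obtain e h' where
    *: "((\<lambda>t. F (a(k := t)) X w) has_field_derivative e) (at (a k))"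
      "((\<lambda>Y. F a Y w) has_derivative h') (at X)" "d = a k * e + h' (flow_field k X)"
    unfolding has_flow_deriv_def by blast
  have theta: "theta k F a X w = a k * e"
    unfolding theta_def using *(1) by (simp add: DERIV_imp_deriv)
  have frechet: "frechet_derivative (\<lambda>Y. F a Y w) (at X) = h'"
    using *(2) by (rule frechet_derivative_at[symmetric])
  have neg: "h' (- X) = - h' X"
    using has_derivative_bounded_linear[OF *(2)] by (simp add: bounded_linear.linear linear_neg)
  have total: "(\<lambda>Y. \<Sum>j\<in>UNIV. euler_field j Y) = (\<lambda>Y. Y)"
    by (auto simp: fun_eq_iff vec_eq_iff euler_field_def axis_def)
  have "linear (euler_field j)" for j
    by (rule linearI) (auto simp: euler_field_def axis_def vec_eq_iff)
  then have "(euler_field j has_derivative euler_field j) (at X)" for j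
    by (intro linear_imp_has_derivative)
  then have euler: "frechet_derivative (euler_field j) (at X) = euler_field j" for j
    by (rule frechet_derivative_at[symmetric])
  have self: "(\<chi> m. if m = i then w $ i else w $ m) = w" for i
    by (simp add: vec_eq_iff)
  have h0: "h' 0 = 0"
    using has_derivative_bounded_linear[OF *(2)] by (simp add: bounded_linear.linear linear_0)
  show ?thesis
    unfolding theta_subst_def theta lie_def total frechet euler *(3)
    using theta neg h0 self
    by (auto simp: flow_field_def euler_field_def frechet_derivative_ident if_distrib[of "($) w"]
        cong: if_cong)
qed

lemma theta_subst_represents:
  assumes "represents p v F g" and "k \<le> p"
    and "\<And>a X. regular p v a X \<Longrightarrow> has_flow_deriv k g (g' a X) a X"
  shows "represents p v (theta_subst k F) g'"
  unfolding represents_def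
proof (intro allI impI)
  fix a X and w :: "(complex ^ 4) ^ 4" assume reg: "regular p v a X"
  let ?\<kappa> = "if k = 0 then 4 else if k \<le> 4 then - 1 else 0 :: complex"
  let ?P = "\<lambda>X. \<Prod>j\<in>UNIV. inverse (X $ j)"
  have F: "F a X u = g a X * (det u * ?P X)" if "regular p v a X" for a X u
    using assms(1) that by (simp add: represents_def dlog_form_eq)
  have nz: "\<forall>j. X $ j \<noteq> 0" using reg by (simp add: regular_def)
  have "has_flow_deriv k (\<lambda>a X. g a X * (det w * ?P X))
      (g' a X * (det w * ?P X) + g a X * (0 * ?P X + det w * (?\<kappa> * ?P X))) a X"
    by (intro has_flow_deriv_mult assms(3)[OF reg] has_flow_deriv_const has_flow_deriv_inverse_coordinates nz)
  then have "has_flow_deriv k (\<lambda>a X. F a X w)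
      (g' a X * (det w * ?P X) + g a X * (0 * ?P X + det w * (?\<kappa> * ?P X))) a X"
    by (rule has_flow_deriv_cong)
      (use regular_eventually[OF reg assms(2)] F in \<open>auto elim: eventually_mono\<close>)
  note * = theta_subst_eq[where F = F, OF this]
  have "(\<Sum>i\<in>UNIV. F a X (\<chi> m. if m = i then axis j (w $ i $ j) else w $ m)) =
      g a X * (det w * ?P X)" for j
    by (simp add: F[OF reg] sum_replace_row_det flip: sum_distrib_left sum_distrib_right)
  then show "theta_subst k F a X w = g' a X * dlog_form X w"
    unfolding * dlog_form_eq by (simp only: F[OF reg, of w]) (simp add: algebra_simps)
qed

section \<open>The terms of the period form\<close>

definition agree :: "nat \<Rightarrow> (nat \<Rightarrow> int ^ 4) \<Rightarrow> pform \<Rightarrow> pform \<Rightarrow> bool" where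
  "agree p v F G \<longleftrightarrow> (\<forall>a X w. regular p v a X \<longrightarrow> F a X w = G a X w)"

lemma represents_imp_agree:
  assumes "represents p v F g" and "represents p v G h"
    and "\<And>a X. regular p v a X \<Longrightarrow> g a X = h a X"
  shows "agree p v F G"
  using assms by (simp add: represents_def agree_def)

text \<open>
  The functions \<open>M(ks)\<close>. Apart from the factor \<open>a\<^sub>0\<close>, these are the partial derivatives
  of \<open>1 / f\<close> in the \<open>a\<^sub>i\<close> at fixed \<open>Y\<close>, multiplied by the corresponding monomial in the \<open>a\<^sub>i\<close>.
\<close>
definition period_term :: "nat \<Rightarrow> (nat \<Rightarrow> int ^ 4) \<Rightarrow> nat list \<Rightarrow> scalar" where
  "period_term p v ks a X =
     a 0 * ((- 1) ^ length ks * fact (length ks)) * (\<Prod>i\<leftarrow>ks. poly_term v i a X) *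
     inverse (defining_poly p v a (phi a X)) ^ Suc (length ks)"

lemma has_flow_deriv_poly_terms:
  assumes "regular p v a X"
  shows "has_flow_deriv k (\<lambda>a X. \<Prod>i\<leftarrow>ks. poly_term v i a X)
    (of_nat (count_list ks k) * (\<Prod>i\<leftarrow>ks. poly_term v i a X)) a X"
proof (induction ks)
  case Nil
  show ?case using has_flow_deriv_const[of k 1] by simp
next
  case (Cons i ks)
  show ?case
    using has_flow_deriv_mult[OF has_flow_deriv_poly_term[OF assms, of k i] Cons.IH]
    by (auto simp: algebra_simps)
qed

lemma has_flow_deriv_period_term:
  assumes "regular p v a X" and "k \<le> p"
  shows "has_flow_deriv k (period_term p v ks)
    (of_nat (count_list ks k + (if k = 0 then 1 else 0)) * period_term p v ks a X
      + period_term p v (k # ks) a X) a X"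
proof -
  let ?n = "length ks" and ?f = "\<lambda>a X. defining_poly p v a (phi a X)"
  have nz: "?f a X \<noteq> 0" using assms by (simp add: regular_def)
  have "((\<lambda>x. inverse x ^ Suc ?n) has_field_derivative
      - (of_nat (Suc ?n) * inverse (?f a X) ^ Suc (Suc ?n))) (at (?f a X))"
    using DERIV_power_Suc[OF DERIV_inverse[OF nz], of ?n]
    by (rule back_subst[where P = "\<lambda>D. (_ has_field_derivative D) _"]) (simp add: algebra_simps)
  from has_flow_deriv_mult[OF
      has_flow_deriv_mult[OF
        has_flow_deriv_mult[OF has_flow_deriv_param[of k 0] has_flow_deriv_const]
        has_flow_deriv_poly_terms[OF assms(1)]]
      has_flow_deriv_chain[where g = ?f, OF has_flow_deriv_defining_poly[OF assms] this],
        of "(- 1) ^ ?n * fact ?n" ks]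
  show ?thesis
    unfolding period_term_def[abs_def]
    by (rule back_subst[where P = "\<lambda>d. has_flow_deriv k _ d a X"]) (simp add: algebra_simps)
qed

inductive_set period_span :: "nat \<Rightarrow> (nat \<Rightarrow> int ^ 4) \<Rightarrow> scalar set" for p v where
  base: "period_term p v ks \<in> period_span p v"
| comb: "g \<in> period_span p v \<Longrightarrow> h \<in> period_span p v \<Longrightarrow> (\<lambda>a X. c * g a X + h a X) \<in> period_span p v"

text \<open>
  Hence the functions in the span can be differentiated along the flows any number of times.
\<close>
lemma period_span_deriv:
  assumes "g \<in> period_span p v" and "k \<le> p"
  shows "\<exists>g'\<in>period_span p v. \<forall>a X. regular p v a X \<longrightarrow> has_flow_deriv k g (g' a X) a X"
  using assms(1)
proof induction
  case (base ks)
  show ?case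
    using has_flow_deriv_period_term[OF _ assms(2)]
    by (intro bexI[OF _ period_span.comb[OF period_span.base[of _ _ ks] period_span.base[of _ _ "k # ks"]]])
      auto
next
  case (comb g h c)
  then obtain g' h' where *: "g' \<in> period_span p v" "h' \<in> period_span p v"
    "\<And>a X. regular p v a X \<Longrightarrow> has_flow_deriv k g (g' a X) a X"
    "\<And>a X. regular p v a X \<Longrightarrow> has_flow_deriv k h (h' a X) a X" by blast
  have "has_flow_deriv k (\<lambda>a X. c * g a X + h a X) (c * g' a X + h' a X) a X" if "regular p v a X" for a X
    using has_flow_deriv_add[OF
        has_flow_deriv_mult[OF has_flow_deriv_const[of k c] *(3)[OF that]] *(4)[OF that]]
    by simp
  then show ?case by (intro bexI[OF _ period_span.comb[OF *(1,2), of c]]) auto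
qed

section \<open>Commuting the factors of the operator\<close>

abbreviation shifted :: "nat \<Rightarrow> int \<Rightarrow> pform \<Rightarrow> pform" where
  "shifted k c F \<equiv> \<lambda>a X w. theta_subst k F a X w - of_int c * F a X w"

lemma shifted_represents:
  assumes "represents p v F g" and "k \<le> p"
    and "\<And>a X. regular p v a X \<Longrightarrow> has_flow_deriv k g (g' a X) a X"
  shows "represents p v (shifted k c F) (\<lambda>a X. - of_int c * g a X + g' a X)"
  using theta_subst_represents[OF assms] assms(1)
  by (simp add: represents_def algebra_simps)

definition in_period_span :: "nat \<Rightarrow> (nat \<Rightarrow> int ^ 4) \<Rightarrow> pform \<Rightarrow> bool" where
  "in_period_span p v F \<longleftrightarrow> (\<exists>g\<in>period_span p v. represents p v F g)"

lemma in_period_span_shifted: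
  assumes "in_period_span p v F" and "k \<le> p"
  shows "in_period_span p v (shifted k c F)"
proof -
  obtain g where g: "g \<in> period_span p v" "represents p v F g"
    using assms(1) unfolding in_period_span_def by blast
  obtain g' where g': "g' \<in> period_span p v"
    "\<And>a X. regular p v a X \<Longrightarrow> has_flow_deriv k g (g' a X) a X"
    using period_span_deriv[OF g(1) assms(2)] by blast
  show ?thesis
    using shifted_represents[OF g(2) assms(2) g'(2)] period_span.comb[OF g(1) g'(1)]
    unfolding in_period_span_def by blast
qed

lemma shifted_agree:
  assumes "agree p v F G" and "in_period_span p v F" and "k \<le> p"
  shows "agree p v (shifted k c F) (shifted k c G)"
proof -
  obtain g where g: "g \<in> period_span p v" "represents p v F g"
    using assms(2) unfolding in_period_span_def by blast
  then have gG: "represents p v G g" using assms(1) by (simp add: represents_def agree_def)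
  obtain g' where g': "\<And>a X. regular p v a X \<Longrightarrow> has_flow_deriv k g (g' a X) a X"
    using period_span_deriv[OF g(1) assms(3)] by blast
  show ?thesis
    using shifted_represents[OF g(2) assms(3) g', of c] shifted_represents[OF gG assms(3) g', of c]
    by (simp add: represents_def agree_def)
qed

text \<open>
  Both sides are polynomials in the same derivation, and the derivation is linear on the span.
\<close>
lemma shifted_commute:
  assumes "in_period_span p v F" and "k \<le> p"
  shows "agree p v (shifted k c (shifted k d F)) (shifted k d (shifted k c F))"
proof -
  obtain g where g: "g \<in> period_span p v" "represents p v F g"
    using assms(1) unfolding in_period_span_def by blast
  obtain g' where g': "g' \<in> period_span p v"
    "\<And>a X. regular p v a X \<Longrightarrow> has_flow_deriv k g (g' a X) a X"
    using period_span_deriv[OF g(1) assms(2)] by blast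
  obtain g'' where g'': "\<And>a X. regular p v a X \<Longrightarrow> has_flow_deriv k g' (g'' a X) a X"
    using period_span_deriv[OF g'(1) assms(2)] by blast
  have deriv: "has_flow_deriv k (\<lambda>a X. - of_int c * g a X + g' a X) (- of_int c * g' a X + g'' a X) a X"
    if "regular p v a X" for c a X
    using has_flow_deriv_add[OF
        has_flow_deriv_mult[OF has_flow_deriv_const[of k "- of_int c"] g'(2)[OF that]] g''[OF that]]
    by simp
  have "represents p v (shifted k c (shifted k d F))
     (\<lambda>a X. - of_int c * (- of_int d * g a X + g' a X) + (- of_int d * g' a X + g'' a X))" for c d
    using shifted_represents[OF shifted_represents[OF g(2) assms(2) g'(2)] assms(2) deriv] .
  from this[of d c] this[of c d] show ?thesis
    by (rule represents_imp_agree) (simp add: algebra_simps)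
qed

lemma shifted_prod_simps:
  "shifted_prod (theta_subst k) [] F = F"
  "shifted_prod (theta_subst k) (c # cs) F = shifted k c (shifted_prod (theta_subst k) cs F)"
  by (simp_all add: shifted_prod_def)

lemma in_period_span_shifted_prod:
  assumes "in_period_span p v F" and "k \<le> p"
  shows "in_period_span p v (shifted_prod (theta_subst k) cs F)"
  by (induction cs) (simp_all add: shifted_prod_simps assms in_period_span_shifted)

lemma agree_trans [trans]: "agree p v F G \<Longrightarrow> agree p v G H \<Longrightarrow> agree p v F H"
  by (simp add: agree_def)

text \<open>
  By definition the last factor of the list acts first. Commutation lets it act last, which is the
  order in which the shifts cancel.
\<close>
lemma shifted_prod_snoc:
  assumes "in_period_span p v F" and "k \<le> p"
  shows "agree p v (shifted_prod (theta_subst k) (cs @ [c]) F)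
    (shifted k c (shifted_prod (theta_subst k) cs F))"
proof (induction cs)
  case Nil
  show ?case by (simp add: shifted_prod_simps agree_def)
next
  case (Cons d cs)
  have "agree p v (shifted k d (shifted_prod (theta_subst k) (cs @ [c]) F))
      (shifted k d (shifted k c (shifted_prod (theta_subst k) cs F)))"
    by (rule shifted_agree[OF Cons.IH in_period_span_shifted_prod[OF assms] assms(2)])
  also have "agree p v \<dots> (shifted k c (shifted k d (shifted_prod (theta_subst k) cs F)))"
    by (rule shifted_commute[OF in_period_span_shifted_prod[OF assms] assms(2)])
  finally show ?case by (simp add: shifted_prod_simps)
qed

section \<open>The two halves of the operator as single terms\<close>

abbreviation term_form :: "nat \<Rightarrow> (nat \<Rightarrow> int ^ 4) \<Rightarrow> nat list \<Rightarrow> pform" where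
  "term_form p v ks \<equiv> \<lambda>a X w. period_term p v ks a X * dlog_form X w"

lemma in_period_span_term_form: "in_period_span p v (term_form p v ks)"
  unfolding in_period_span_def represents_def using period_span.base by blast

lemma agree_term_in_period_span:
  "agree p v F (term_form p v ks) \<Longrightarrow> in_period_span p v F"
  using in_period_span_term_form[of p v ks] by (auto simp: agree_def in_period_span_def represents_def)

text \<open>
  The shift cancels the multiple of the old term in \<open>has_flow_deriv_period_term\<close>, and only the
  longer term survives.
\<close>
lemma shifted_term_form:
  assumes "agree p v F (term_form p v ks)" and "k \<le> p"
  shows "agree p v (shifted k (int (count_list ks k) + (if k = 0 then 1 else 0)) F)
    (term_form p v (k # ks))"
proof -
  have "represents p v F (period_term p v ks)"
    using assms(1) by (simp add: represents_def agree_def)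
  from shifted_represents[OF this assms(2) has_flow_deriv_period_term[OF _ assms(2)]]
  show ?thesis
    by (rule represents_imp_agree[where h = "period_term p v (k # ks)"])
      (simp_all add: represents_def algebra_simps)
qed

text \<open>
  The count of \<open>k\<close> grows by one with every factor, and so do the shifts. The start value \<open>1\<close> for
  \<open>k = 0\<close> accounts for the prefactor \<open>a\<^sub>0\<close> of the terms.
\<close>
lemma shifted_prod_term_form:
  assumes "agree p v F (term_form p v ks)" and "k \<le> p" and "k \<notin> set ks"
    and "c = (if k = 0 then 1 else 0)"
  shows "agree p v (shifted_prod (theta_subst k) [c..c + int n - 1] F)
    (term_form p v (replicate n k @ ks))"
proof (induction n)
  case 0
  with assms(1) show ?case by (simp add: shifted_prod_simps)
next
  case (Suc n)
  have "[c..c + int (Suc n) - 1] = [c..c + int n - 1] @ [c + int n]"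
    by (subst upto_rec2) auto
  moreover have "count_list (replicate n k @ ks) k = n"
    using assms(3) by (induction n) (auto simp: count_list_0_iff)
  ultimately show ?case
    using agree_trans[OF shifted_prod_snoc[OF agree_term_in_period_span[OF assms(1)] assms(2)]
        shifted_term_form[OF Suc.IH assms(2)]] assms(4)
    by (simp add: add.commute)
qed

definition exponent_list :: "(nat \<Rightarrow> int) \<Rightarrow> nat list \<Rightarrow> nat list" where
  "exponent_list l js = concat (map (\<lambda>i. replicate (nat (l i)) i) js)"

lemma set_exponent_list: "set (exponent_list l js) \<subseteq> set js"
  by (auto simp: exponent_list_def)

lemma op_prod_term_form:
  assumes "agree p v F (term_form p v [])" and "distinct js" and "set js \<subseteq> {1..p}"
    and "\<forall>i\<in>set js. l i > 0"
  shows "agree p v (op_prod (\<lambda>i. shifted_prod (theta_subst i) [0..l i - 1]) js F)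
    (term_form p v (exponent_list l js))"
  using assms(2-)
proof (induction js)
  case Nil
  with assms(1) show ?case by (simp add: op_prod_def exponent_list_def)
next
  case (Cons i js)
  then have "i \<notin> set (exponent_list l js)" using set_exponent_list by fastforce
  with Cons shifted_prod_term_form[OF Cons.IH, of i 0 "nat (l i)"]
  show ?case by (simp add: op_prod_def exponent_list_def)
qed

lemma monomial_operator_term_form:
  assumes "agree p v F (term_form p v [])"
  shows "agree p v
    ((shifted_prod (theta_subst 0) [1..l 0] \<circ>
      op_prod (\<lambda>i. shifted_prod (theta_subst i) [0..l i - 1]) [i \<leftarrow> [1..<Suc p]. l i > 0]) F)
    (term_form p v (exponent_list l [0..<Suc p]))"
proof -
  let ?js = "[i \<leftarrow> [1..<Suc p]. l i > 0]"
  have "agree p v (op_prod (\<lambda>i. shifted_prod (theta_subst i) [0..l i - 1]) ?js F)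
    (term_form p v (exponent_list l ?js))"
    by (intro op_prod_term_form assms) auto
  moreover have "0 \<notin> set (exponent_list l ?js)"
    using set_exponent_list[of l ?js] by auto
  ultimately have "agree p v
    (shifted_prod (theta_subst 0) [1..1 + int (nat (l 0)) - 1]
      (op_prod (\<lambda>i. shifted_prod (theta_subst i) [0..l i - 1]) ?js F))
    (term_form p v (replicate (nat (l 0)) 0 @ exponent_list l ?js))"
    by (intro shifted_prod_term_form) auto
  \<comment> \<open>For negative \<open>l 0\<close> both intervals are empty.\<close>
  moreover have "[1..1 + int (nat (l 0)) - 1] = [1..l 0]"
    by (cases "l 0 \<ge> 0") auto
  moreover have "exponent_list l ?js = exponent_list l [1..<Suc p]"
  proof -
    have "exponent_list l (filter (\<lambda>i. l i > 0) js) = exponent_list l js" for js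
      by (induction js) (auto simp: exponent_list_def)
    then show ?thesis .
  qed
  moreover have "exponent_list l [0..<Suc p] = replicate (nat (l 0)) 0 @ exponent_list l [1..<Suc p]"
    by (subst upt_conv_Cons) (auto simp: exponent_list_def)
  ultimately show ?thesis by simp
qed

text \<open>
  As \<open>phi a\<close> is linear and diagonal, it preserves each \<open>dX\<^sub>j / X\<^sub>j\<close>.
\<close>
lemma Pi_tilde_agree: "agree p v (Pi_tilde p v) (term_form p v [])"
  unfolding agree_def
proof (intro allI impI)
  fix a X and w :: "(complex ^ 4) ^ 4" assume reg: "regular p v a X"
  have nz: "a i \<noteq> 0" if "i \<in> {0..4}" for i using reg that by (simp add: regular_def)
  have "phi a (Y + Z) $ j = phi a Y $ j + phi a Z $ j"
    and "phi a (r *\<^sub>R Y) $ j = r *\<^sub>R (phi a Y $ j)" for Y Z r j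
    using index_cases[of j] by (auto simp: phi_nth algebra_simps)
  then have "linear (phi a)"
    by (intro linearI) (simp_all add: vec_eq_iff)
  then have D: "frechet_derivative (phi a) (at X) = phi a"
    by (intro frechet_derivative_at[symmetric] linear_imp_has_derivative)
  have "phi a (w $ i) $ j / phi a X $ j = w $ i $ j / X $ j" for i j
    using index_cases[of j] nz by (auto simp: phi_nth)
  then show "Pi_tilde p v a X w = period_term p v [] a X * dlog_form X w"
    by (simp add: Pi_tilde_def pullback_def D Pi_form_def dlog_form_def period_term_def divide_inverse)
qed

section \<open>The relation between the two terms\<close>

lemma prod_exponent_list:
  fixes f :: "nat \<Rightarrow> 'a :: comm_monoid_mult"
  shows "(\<Prod>i\<leftarrow>exponent_list l [0..<Suc p]. f i) = (\<Prod>i\<le>p. f i ^ nat (l i))"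
proof -
  have "(\<Prod>i\<leftarrow>exponent_list l js. f i) = (\<Prod>i\<leftarrow>js. f i ^ nat (l i))" for js
    by (induction js) (simp_all add: exponent_list_def)
  then show ?thesis
    by (simp add: prod.distinct_set_conv_list[symmetric] atLeast0LessThan lessThan_Suc_atMost
        del: upt_Suc)
qed

lemma length_exponent_list:
  "length (exponent_list l [0..<Suc p]) = (\<Sum>i\<le>p. nat (l i))"
proof -
  have "length (exponent_list l js) = (\<Sum>i\<leftarrow>js. nat (l i))" for js
    by (induction js) (simp_all add: exponent_list_def)
  then show ?thesis
    by (simp add: sum.distinct_set_conv_list[symmetric] atLeast0LessThan lessThan_Suc_atMost
        del: upt_Suc)
qed

lemma relation_lattice_sums:
  assumes "l \<in> relation_lattice p v"
  shows "(\<Sum>i\<le>p. l i) = 0" and "(\<Sum>i\<le>p. v i $ j * l i) = 0"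
proof -
  have *: "(\<Sum>i\<le>p. of_int (l i) *\<^sub>R ((1, embed (v i)) :: real \<times> (real ^ 4))) = 0"
    using assms by (simp add: relation_lattice_def)
  from arg_cong[OF *, of fst] have "(\<Sum>i\<le>p. real_of_int (l i)) = 0"
    by (simp add: fst_sum)
  then show "(\<Sum>i\<le>p. l i) = 0"
    by (simp flip: of_int_sum)
  from arg_cong[OF *, of "\<lambda>x. snd x $ j"] have "(\<Sum>i\<le>p. real_of_int (v i $ j * l i)) = 0"
    by (simp add: snd_sum embed_def mult.commute)
  then show "(\<Sum>i\<le>p. v i $ j * l i) = 0"
    by (simp only: of_int_sum[symmetric] of_int_eq_0_iff)
qed

lemma power_int_sum:
  fixes y :: "'a :: field"
  assumes "y \<noteq> 0"
  shows "y powi (\<Sum>i\<in>I. n i) = (\<Prod>i\<in>I. y powi n i)"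
  by (induction I rule: infinite_finite_induct) (simp_all add: assms power_int_add)

lemma power_int_prod:
  fixes f :: "'b \<Rightarrow> 'a :: field"
  shows "(\<Prod>i\<in>I. f i) powi n = (\<Prod>i\<in>I. f i powi n)"
  by (induction I rule: infinite_finite_induct) (simp_all add: power_int_mult_distrib)

lemma relation_monomial:
  assumes "l \<in> relation_lattice p v" and "\<forall>j. Y $ j \<noteq> 0"
  shows "(\<Prod>i\<le>p. laurent_monomial Y (v i) powi l i) = 1"
proof -
  have "(\<Prod>i\<le>p. laurent_monomial Y (v i) powi l i) =
      (\<Prod>j\<in>UNIV. \<Prod>i\<le>p. (Y $ j) powi (v i $ j * l i))"
    unfolding laurent_monomial_def power_int_prod
    by (subst prod.swap) (simp add: power_int_mult)
  also have "\<dots> = 1"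
    using assms(2) relation_lattice_sums(2)[OF assms(1)] by (simp flip: power_int_sum)
  finally show ?thesis .
qed

lemma power_nat_eq_power_int:
  fixes x :: "'a :: field"
  assumes "n < 0 \<longrightarrow> x \<noteq> 0"
  shows "x ^ nat n = x powi n * x ^ nat (- n)"
  using assms by (auto simp: power_int_def field_simps)

text \<open>
  A parameter \<open>a\<^sub>i\<close> with \<open>i > 4\<close> and \<open>l\<^sub>i > 0\<close> may vanish; then both sides are \<open>0\<close>. Where \<open>l\<^sub>i < 0\<close>
  it must not, since \<open>a\<^sub>i\<close> is then inverted.
\<close>
lemma period_term_relation:
  assumes "l \<in> relation_lattice p v" and "regular p v a X" and "\<forall>i\<le>p. l i < 0 \<longrightarrow> a i \<noteq> 0"
  shows "period_term p v (exponent_list l [0..<Suc p]) a X =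
    param_monomial p a l * period_term p v (exponent_list (\<lambda>i. - l i) [0..<Suc p]) a X"
proof -
  have nz: "\<forall>j. phi a X $ j \<noteq> 0" using phi_nonzero[OF assms(2)] by blast
  have "laurent_monomial (phi a X) m \<noteq> 0" for m
    using nz by (simp add: laurent_monomial_def)
  then have "poly_term v i a X ^ nat (l i) =
      a i powi l i * laurent_monomial (phi a X) (v i) powi l i * poly_term v i a X ^ nat (- l i)"
    if "i \<le> p" for i
    using assms(3) that
    by (subst power_nat_eq_power_int) (auto simp: poly_term_def power_int_mult_distrib)
  then have "(\<Prod>i\<le>p. poly_term v i a X ^ nat (l i)) =
      param_monomial p a l * (\<Prod>i\<le>p. poly_term v i a X ^ nat (- l i))"
    using relation_monomial[OF assms(1) nz] by (simp add: prod.distrib param_monomial_def)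
  moreover have "(\<Sum>i\<le>p. nat (l i)) = (\<Sum>i\<le>p. nat (- l i))"
  proof -
    have "int (\<Sum>i\<le>p. nat (l i)) - int (\<Sum>i\<le>p. nat (- l i)) = (\<Sum>i\<le>p. l i)"
      by (auto simp: sum_subtractf[symmetric] intro!: sum.cong)
    then show ?thesis using relation_lattice_sums(1)[OF assms(1)] by linarith
  qed
  ultimately show ?thesis
    by (simp add: period_term_def prod_exponent_list length_exponent_list del: upt_Suc)
qed

theorem proposition3p3:
  fixes \<Delta> :: "(real ^ 4) set" and p :: nat and v :: "nat \<Rightarrow> int ^ 4"
    and l :: "nat \<Rightarrow> int" and a :: "nat \<Rightarrow> complex"
    and X :: "complex ^ 4" and w :: "(complex ^ 4) ^ 4"
  assumes "integral_polytope \<Delta>"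
    and "bij_betw v {..p} (lattice_points \<Delta>)"
    and "4 \<le> p"
    and "v 0 = 0" and "v 1 = axis 1 1" and "v 2 = axis 2 1"
    and "v 3 = axis 3 1" and "v 4 = axis 4 1"
    and "l \<in> relation_lattice p v"
    and "\<forall>i\<le>4. a i \<noteq> 0"
    and "\<forall>i\<le>p. l i < 0 \<longrightarrow> a i \<noteq> 0"
    and "\<forall>j. X $ j \<noteq> 0"
    and "defining_poly p v a (phi a X) \<noteq> 0"
  shows "D_op theta_subst p l (Pi_tilde p v) a X w = 0"
proof -
  have reg: "regular p v a X"
    using assms by (simp add: regular_def)
  have *: "((shifted_prod (theta_subst 0) [1..l 0] \<circ>
      op_prod (\<lambda>i. shifted_prod (theta_subst i) [0..l i - 1]) [i \<leftarrow> [1..<Suc p]. l i > 0])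
      (Pi_tilde p v)) a X w =
      period_term p v (exponent_list l [0..<Suc p]) a X * dlog_form X w" for l
    using monomial_operator_term_form[OF Pi_tilde_agree] reg unfolding agree_def by blast
  \<comment> \<open>The second half of the operator is the first half for the relation \<open>- l\<close>.\<close>
  show ?thesis
    using *[of l] *[of "\<lambda>i. - l i"] period_term_relation[OF assms(9) reg assms(11)]
    by (simp add: D_op_def del: upt_Suc)
qed

end
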